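(* Let $T\in\ell_\infty^n\otimes\ell_2^m$ be of rank $r$. Then $$\|T\|\le\pi_2(T^* )\le\nu_1(T)\le\sqrt{2r}\,\|T\|.$$
   Context: $T=\sum_kx_k\otimes y_k\in X\otimes Y$ is viewed as the linear operator $X^*\to Y$, $x^*\mapsto\sum_kx^*(x_k)y_k$ (here $\ell_1^n\to\ell_2^m$); $\|T\|$ is its operator norm and $T^*:Y^*\to X$ (here $\ell_2^m\to\ell_\infty^n$) its adjoint. The 1-nuclear norm is $\nu_1(T)=\inf\{\sum_{k=1}^\infty\|x_k\|_X\|y_k\|_Y:\ T=\sum_{k=1}^\infty x_k\otimes y_k\}$. For a linear operator $S:E\to F$ between Banach spaces, the 2-summing norm $\pi_2(S)$ is the smallest $c>0$ such that $\sum_k\|Sz_k\|_F^2\le c^2\sup_{z^*\in B_{E^*}}\sum_k|z^*(z_k)|^2$ for all finite sequences $(z_k)\subset E$. *)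

theory Defs
  imports "HOL-Analysis.Analysis"
begin

text \<open>
  Conventions. A tensor in the tensor product of \<open>\<ell>\<^sub>\<infinity>\<^sup>n\<close> and \<open>\<ell>\<^sub>2\<^sup>m\<close> is given by its matrix
  \<open>T :: 'k ^ 'n ^ 'm\<close> of coordinates, so that \<open>x \<otimes> y\<close> has entry \<open>x $ i * y $ j\<close> in row \<open>j\<close> and
  column \<open>i\<close>. Dual spaces are identified with coordinate spaces through the bilinear pairing
  \<open>\<Sum>i. a $ i * x $ i\<close>, also over the complex numbers. With this identification the operator
  \<open>\<ell>\<^sub>1\<^sup>n \<rightarrow> \<ell>\<^sub>2\<^sup>m\<close> given by the tensor is \<open>(*v) T\<close>, and its Banach space adjoint
  \<open>\<ell>\<^sub>2\<^sup>m \<rightarrow> \<ell>\<^sub>\<infinity>\<^sup>n\<close> is \<open>(*v) (transpose T)\<close>; see \<open>tensor_mult\<close> and \<open>transpose_pairing\<close> below.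
  The norm of \<open>\<ell>\<^sub>2\<^sup>m\<close> is the library norm of \<open>'k ^ 'm\<close>; other norms are passed as functions.

  Scalars. The real and the complex case are treated together by the sort
  \<open>{real_normed_field, real_inner}\<close>, which contains the types \<open>real\<close> and \<open>complex\<close>, and (by
  Gelfand-Mazur) nothing else up to isometric isomorphism.
\<close>

definition l1_norm :: "'k::real_normed_field ^ 'n \<Rightarrow> real"
  where "l1_norm x = (\<Sum>i\<in>UNIV. norm (x $ i))"

definition linf_norm :: "'k::real_normed_field ^ 'n \<Rightarrow> real"
  where "linf_norm x = Max (range (\<lambda>i. norm (x $ i)))"

definition tensor :: "'k::real_normed_field ^ 'n \<Rightarrow> 'k ^ 'm \<Rightarrow> 'k ^ 'n ^ 'm"
  where "tensor x y = (\<chi> j i. x $ i * y $ j)"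

definition operator_norm ::
    "('k::real_normed_field ^ 'n \<Rightarrow> real) \<Rightarrow> ('k ^ 'm \<Rightarrow> real) \<Rightarrow> ('k ^ 'n \<Rightarrow> 'k ^ 'm) \<Rightarrow> real"
  where "operator_norm NE NF S = (SUP x\<in>{x. NE x \<le> 1}. NF (S x))"

text \<open>
  Representations with a divergent sum of norms have the value infinity and do not affect the
  infimum; there is always a finite representation, so the set is nonempty.
\<close>

definition nuclear_norm ::
    "('k::real_normed_field ^ 'n \<Rightarrow> real) \<Rightarrow> ('k ^ 'm \<Rightarrow> real) \<Rightarrow> 'k ^ 'n ^ 'm \<Rightarrow> real"
  where "nuclear_norm NX NY T =
    Inf {\<Sum>k. NX (x k) * NY (y k) | x y.
           (\<lambda>k. tensor (x k) (y k)) sums T \<and> summable (\<lambda>k. NX (x k) * NY (y k))}"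

definition dual_ball :: "('k::real_normed_field ^ 'n \<Rightarrow> real) \<Rightarrow> ('k ^ 'n \<Rightarrow> 'k) set"
  where "dual_ball N = {\<phi>. Vector_Spaces.linear (*s) (*) \<phi> \<and> (\<forall>z. norm (\<phi> z) \<le> N z)}"

text \<open>
  The smallest constant is attained except for \<open>S = 0\<close>, where every \<open>c > 0\<close> is admissible and the
  infimum is \<open>0\<close>.
\<close>

definition two_summing_norm ::
    "('k::real_normed_field ^ 'n \<Rightarrow> real) \<Rightarrow> ('k ^ 'm \<Rightarrow> real) \<Rightarrow> ('k ^ 'n \<Rightarrow> 'k ^ 'm) \<Rightarrow> real"
  where "two_summing_norm NE NF S =
    Inf {c. c > 0 \<and> (\<forall>(K::nat) z. (\<Sum>k<K. (NF (S (z k)))\<^sup>2)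
              \<le> c\<^sup>2 * (SUP \<phi>\<in>dual_ball NE. \<Sum>k<K. (norm (\<phi> (z k)))\<^sup>2))}"

lemma tensor_mult: "tensor x y *v a = (\<Sum>i\<in>UNIV. a $ i * x $ i) *s y"
  by (simp add: tensor_def matrix_vector_mult_def vector_scalar_mult_def vec_eq_iff
      sum_distrib_left mult_ac)

lemma transpose_pairing:
  fixes T :: "'k::real_normed_field ^ 'n ^ 'm"
  shows "(\<Sum>j\<in>UNIV. y $ j * (T *v a) $ j) = (\<Sum>i\<in>UNIV. a $ i * (transpose T *v y) $ i)"
  unfolding matrix_vector_mult_def transpose_def vec_lambda_beta sum_distrib_left
  by (subst sum.swap) (simp add: mult_ac)

end

theory Submission
  imports Defs
begin

text \<open>
  Why the chain of inequalities holds. The first two are soft. Testing the 2-summing inequality of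
  the adjoint on one vector bounds its operator norm, which is that of \<open>T\<close>. The adjoint of a rank one
  tensor \<open>x \<otimes> y\<close> has 2-summing norm at most \<open>\<parallel>x\<parallel> * \<parallel>y\<parallel>\<close>, so every nuclear representation of \<open>T\<close> bounds the
  2-summing norm by the triangle inequality in \<open>\<ell>\<^sub>2\<close>.

  The last inequality needs an economical nuclear representation. The operator norm on \<open>\<ell>\<^sub>1\<close> is the
  largest norm of a column of \<open>T\<close>, and the columns lie in a space with an orthonormal basis \<open>U\<close> of
  at most \<open>r\<close> elements (\<open>columns_in_span_of_rank\<close>). The vertices \<open>\<theta>\<^sub>\<epsilon> = \<Sum>u\<in>U. \<epsilon>\<^sub>u u\<close> of the cube
  spanned by \<open>U\<close> all have norm at most \<open>\<surd>r\<close>. The key point is that every vector \<open>a\<close> of the span is, up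
  to an arbitrarily small error, an average of scalar multiples \<open>x\<^sub>\<epsilon> \<theta>\<^sub>\<epsilon>\<close> with \<open>\<bar>x\<^sub>\<epsilon>\<bar> \<le> \<surd>2 * \<parallel>a\<parallel>\<close>
  (\<open>approximate_by_cube_vertices\<close>). Applied to all columns at once, it represents \<open>T\<close> as an average
  over \<open>\<epsilon>\<close> of tensors \<open>x\<^sub>\<epsilon> \<otimes> \<theta>\<^sub>\<epsilon>\<close> with \<open>\<parallel>x\<^sub>\<epsilon>\<parallel> \<le> \<surd>2 * \<parallel>T\<parallel>\<close> in \<open>\<ell>\<^sub>\<infinity>\<close> and \<open>\<parallel>\<theta>\<^sub>\<epsilon>\<parallel> \<le> \<surd>r\<close>
  (\<open>nuclear_norm_le_sqrt_card\<close>), which is the bound \<open>\<surd>(2 * r) * \<parallel>T\<parallel>\<close>.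

  The averaging statement is dual to Khintchine's inequality between first and second moments of
  sums with random signs, with the constant \<open>\<surd>2\<close>. This is proved in \<open>kahane_khintchine\<close> by Fourier
  analysis on the cube, and dualized by a separation argument (\<open>closure_convex_if_support\<close>). Only
  real signs occur, also for complex scalars, so both cases are treated together; all that is
  used about the scalars is a conjugation \<open>z \<mapsto> conjugate z\<close> with \<open>conjugate z * z = \<bar>z\<bar>\<^sup>2\<close>.
\<close>

section \<open>The conjugation of the scalar field\<close>

text \<open>
  The reflection of \<open>z\<close> in the real line \<open>\<real>1\<close>: the identity on real numbers and complex
  conjugation on complex numbers.
\<close>

definition conjugate :: "'k::{real_normed_field,real_inner} \<Rightarrow> 'k"
  where "conjugate z = (2 * inner 1 z) *\<^sub>R 1 - z"

lemma inner_one_one [simp]: "inner 1 (1 :: 'k::{real_normed_field,real_inner}) = 1"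
  by (simp add: power2_norm_eq_inner[symmetric])

lemma inner_one_of_real [simp]: "inner 1 (of_real a :: 'k::{real_normed_field,real_inner}) = a"
  by (simp add: of_real_def power2_norm_eq_inner[symmetric])

text \<open>
  With \<open>n = norm w\<close>, orthogonality gives \<open>n + w\<close> and \<open>n - w\<close> the norm \<open>\<surd>2 * n\<close>, so their product
  \<open>n\<^sup>2 - w\<^sup>2\<close> has norm \<open>2 * n\<^sup>2\<close>. That is the equality case of the triangle inequality for two
  vectors of norm \<open>n\<^sup>2\<close> in an inner product space, and it forces \<open>w\<^sup>2 = - n\<^sup>2\<close>; the parallelogram
  law makes this explicit.
\<close>

lemma square_of_imaginary:
  fixes w :: "'k::{real_normed_field,real_inner}"
  assumes "inner 1 w = 0"
  shows "w * w = - of_real ((norm w)\<^sup>2)"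
proof -
  define n where "n = norm w"
  have i1: "inner (of_real a) v = a * inner 1 v" for a and v :: 'k
    by (simp add: of_real_def)
  have "inner w w = n\<^sup>2" by (simp add: n_def power2_norm_eq_inner)
  then have "(norm (of_real n + w))\<^sup>2 = 2 * n\<^sup>2" "(norm (of_real n - w))\<^sup>2 = 2 * n\<^sup>2"
    unfolding power2_norm_eq_inner using assms
    by (simp_all add: i1 inner_commute[of w "of_real n"] inner_add_left inner_add_right
        inner_diff_left inner_diff_right power2_eq_square)
  then have "(norm ((of_real n + w) * (of_real n - w)))\<^sup>2 = (2 * n\<^sup>2) * (2 * n\<^sup>2)"
    by (simp only: norm_mult power_mult_distrib)
  also have "\<dots> = 4 * n ^ 4" by (simp add: power2_eq_square power4_eq_xxxx)
  finally have "(norm ((of_real n + w) * (of_real n - w)))\<^sup>2 = 4 * n ^ 4" .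
  moreover have "(of_real n + w) * (of_real n - w) = of_real (n\<^sup>2) - w * w"
    by (simp add: algebra_simps power2_eq_square)
  ultimately have 1: "(norm (of_real (n\<^sup>2) - w * w))\<^sup>2 = 4 * n^4"
    by simp
  have par: "(norm (a + b))\<^sup>2 + (norm (a - b))\<^sup>2 = 2 * (norm a)\<^sup>2 + 2 * (norm b)\<^sup>2" for a b :: 'k
    by (simp add: power2_norm_eq_inner algebra_simps)
  have "(norm (of_real (n\<^sup>2) :: 'k))\<^sup>2 = n ^ 4" "(norm (w * w))\<^sup>2 = n ^ 4"
    by (simp_all only: norm_of_real norm_mult n_def[symmetric] power2_abs)
      (simp_all add: power2_eq_square power4_eq_xxxx)
  then have "(norm (of_real (n\<^sup>2) + w * w))\<^sup>2 = 0"
    using par[of "of_real (n\<^sup>2)" "w * w"] 1 by linarith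
  then have "of_real (n\<^sup>2) + w * w = 0"
    by (simp only: power_eq_0_iff norm_eq_zero)
  then show ?thesis
    unfolding n_def by (metis add_eq_0_iff)
qed

text \<open>
  This identity says that, away from \<open>0\<close>, the conjugate is the norm squared divided by \<open>z\<close>; from
  it multiplicativity and the compatibility with the inner product follow without
  distinguishing real from complex scalars.
\<close>

lemma conjugate_mult_self:
  fixes z :: "'k::{real_normed_field,real_inner}"
  shows "conjugate z * z = of_real ((norm z)\<^sup>2)"
proof -
  define a where "a = inner 1 z"
  define w where "w = z - of_real a"
  have w0: "inner 1 w = 0" by (simp add: w_def inner_diff_right a_def)
  have z: "z = of_real a + w" by (simp add: w_def)
  have "inner (of_real a) w = 0" "inner w (of_real a) = 0"
    using w0 by (simp_all add: of_real_def inner_commute[of w])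
  then have "(norm z)\<^sup>2 = a\<^sup>2 + (norm w)\<^sup>2"
    unfolding z power2_norm_eq_inner
    by (simp add: inner_add_left inner_add_right) (simp add: of_real_def power2_eq_square power2_norm_eq_inner[symmetric])
  moreover have "conjugate z * z = of_real (a\<^sup>2) - w * w"
    by (simp add: conjugate_def a_def[symmetric]) (simp add: z algebra_simps power2_eq_square scaleR_conv_of_real)
  ultimately show ?thesis by (simp only: square_of_imaginary[OF w0] of_real_add) simp
qed

lemma norm_conjugate [simp]: "norm (conjugate z) = norm z"
proof (cases "z = 0")
  case False
  have "norm (conjugate z * z) = (norm z)\<^sup>2"
    by (simp only: conjugate_mult_self norm_of_real abs_power2)
  with False show ?thesis by (simp add: norm_mult power2_eq_square)
qed (simp add: conjugate_def)

lemma conjugate_add: "conjugate (x + y) = conjugate x + conjugate y"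
  by (simp add: conjugate_def inner_add_right scaleR_add_left ring_distribs)

lemma conjugate_0 [simp]: "conjugate 0 = 0"
  by (simp add: conjugate_def)

lemma conjugate_sum: "conjugate (sum f A) = (\<Sum>i\<in>A. conjugate (f i))"
  by (induction A rule: infinite_finite_induct) (simp_all add: conjugate_add)

lemma conjugate_mult: "conjugate (x * y) = conjugate x * conjugate y"
proof (cases "x * y = 0")
  case False
  have "conjugate (x * y) * (x * y) = (conjugate x * x) * (conjugate y * y)"
    unfolding conjugate_mult_self by (simp add: norm_mult power_mult_distrib)
  then have "conjugate (x * y) * (x * y) = conjugate x * conjugate y * (x * y)" by (simp add: mult_ac)
  with False show ?thesis by (metis mult_right_cancel)
qed (auto simp: conjugate_def)

lemma conjugate_conjugate [simp]: "conjugate (conjugate z) = z"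
  by (simp add: conjugate_def inner_diff_right)

lemma inner_one_conjugate [simp]: "inner 1 (conjugate z) = inner 1 z"
  by (simp add: conjugate_def inner_diff_right)

text \<open>
  Polarization of \<open>conjugate_mult_self\<close>: the real inner product is the real part of the
  Hermitian one.
\<close>

lemma inner_eq_conjugate_mult:
  fixes x y :: "'k::{real_normed_field,real_inner}"
  shows "inner x y = inner 1 (conjugate x * y)"
proof -
  have sq: "(norm v)\<^sup>2 = inner 1 (conjugate v * v)" for v :: 'k
    by (simp only: conjugate_mult_self inner_one_of_real)
  have "conjugate (conjugate x * y) = conjugate y * x" by (simp add: conjugate_mult mult.commute)
  then have s: "inner 1 (conjugate y * x) = inner 1 (conjugate x * y)"
    by (metis inner_one_conjugate)
  have "(norm (x + y))\<^sup>2 = (norm x)\<^sup>2 + (norm y)\<^sup>2 + 2 * inner 1 (conjugate x * y)"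
    unfolding sq by (simp add: conjugate_add ring_distribs inner_add_right s)
  moreover have "(norm (x + y))\<^sup>2 = (norm x)\<^sup>2 + (norm y)\<^sup>2 + 2 * inner x y"
    by (simp add: power2_norm_eq_inner inner_add_left inner_add_right inner_commute[of y x])
  ultimately show ?thesis by simp
qed

section \<open>Fourier analysis on the discrete cube\<close>

text \<open>
  A point of the cube \<open>{-1, 1}\<^sup>I\<close> is encoded by the set \<open>A \<subseteq> I\<close> of its negative coordinates.
  Changing the sign of coordinate \<open>j\<close> then replaces \<open>A\<close> by \<open>sym_diff A {j}\<close>, and the antipode is
  \<open>I - A\<close>.
\<close>

definition rademacher :: "'i set \<Rightarrow> 'i \<Rightarrow> real"
  where "rademacher A j = (if j \<in> A then -1 else 1)"

text \<open>
  The Fourier coefficient at the character \<open>\<epsilon> \<mapsto> \<Prod>j\<in>S. \<epsilon> j\<close>, up to the factor \<open>1 / 2 ^ card I\<close>.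
\<close>

definition walsh :: "'i set \<Rightarrow> ('i set \<Rightarrow> real) \<Rightarrow> 'i set \<Rightarrow> real"
  where "walsh I f S = (\<Sum>A\<in>Pow I. prod (rademacher A) S * f A)"

text \<open>
  Expanding \<open>\<Prod>j\<in>I. (1 + \<epsilon> j * \<delta> j)\<close> over subsets gives the left-hand side, and a factor vanishes
  as soon as the two points differ in one coordinate.
\<close>

lemma walsh_orthogonality:
  assumes "finite I" "A \<subseteq> I" "B \<subseteq> I"
  shows "(\<Sum>S\<in>Pow I. prod (rademacher A) S * prod (rademacher B) S) = (if A = B then 2 ^ card I else 0)"
proof -
  have "(\<Sum>S\<in>Pow I. prod (rademacher A) S * prod (rademacher B) S) = (\<Prod>j\<in>I. rademacher A j * rademacher B j + 1)"
    by (subst prod_add[OF assms(1)]) (simp add: prod.distrib)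
  also have "\<dots> = (if A = B then 2 ^ card I else 0)"
  proof (cases "A = B")
    case True
    have "rademacher B j * rademacher B j + 1 = 2" for j by (simp add: rademacher_def)
    with True show ?thesis by simp
  next
    case False
    then obtain j where "j \<in> I" "j \<in> A \<longleftrightarrow> j \<notin> B"
      using assms by blast
    then have "j \<in> I" "rademacher A j * rademacher B j + 1 = 0"
      by (auto simp: rademacher_def)
    with False assms(1) show ?thesis by (auto intro!: prod_zero)
  qed
  finally show ?thesis .
qed

lemma walsh_parseval:
  assumes "finite I"
  shows "(\<Sum>S\<in>Pow I. walsh I f S * walsh I g S) = 2 ^ card I * (\<Sum>A\<in>Pow I. f A * g A)"
proof -
  have "(\<Sum>S\<in>Pow I. walsh I f S * walsh I g S)
      = (\<Sum>S\<in>Pow I. \<Sum>A\<in>Pow I. \<Sum>B\<in>Pow I. f A * g B * (prod (rademacher A) S * prod (rademacher B) S))"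
  proof (rule sum.cong[OF refl])
    fix S
    have "walsh I f S * walsh I g S
      = (\<Sum>A\<in>Pow I. \<Sum>B\<in>Pow I. prod (rademacher A) S * f A * (prod (rademacher B) S * g B))"
      unfolding walsh_def by (rule sum_product)
    then show "walsh I f S * walsh I g S
      = (\<Sum>A\<in>Pow I. \<Sum>B\<in>Pow I. f A * g B * (prod (rademacher A) S * prod (rademacher B) S))"
      by (simp only: mult_ac)
  qed
  also have "\<dots> = (\<Sum>A\<in>Pow I. \<Sum>S\<in>Pow I. \<Sum>B\<in>Pow I. f A * g B * (prod (rademacher A) S * prod (rademacher B) S))"
    by (rule sum.swap)
  also have "\<dots> = (\<Sum>A\<in>Pow I. \<Sum>B\<in>Pow I. \<Sum>S\<in>Pow I. f A * g B * (prod (rademacher A) S * prod (rademacher B) S))"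
    by (intro sum.cong refl sum.swap)
  also have "\<dots> = (\<Sum>A\<in>Pow I. \<Sum>B\<in>Pow I. if A = B then f A * g B * 2 ^ card I else 0)"
    unfolding sum_distrib_left[symmetric]
    by (intro sum.cong refl) (simp add: walsh_orthogonality[OF assms])
  also have "\<dots> = 2 ^ card I * (\<Sum>A\<in>Pow I. f A * g A)"
    using assms by (simp add: sum_distrib_left mult_ac)
  finally show ?thesis .
qed

text \<open>
  Changing one sign is diagonal in the Walsh basis. Summed over \<open>j\<close>, it multiplies the
  coefficient at \<open>S\<close> by \<open>card I - 2 * card S\<close>, which is how the degree of a character enters.
\<close>

lemma walsh_flip:
  assumes "j \<in> I" "finite S"
  shows "walsh I (\<lambda>A. f (sym_diff A {j})) S = rademacher S j * walsh I f S"
proof -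
  have "rademacher (sym_diff A {j}) k = (if k = j then - 1 else 1) * rademacher A k" for A k
    by (cases "k = j"; cases "k \<in> A") (simp_all add: rademacher_def)
  then have "rademacher (sym_diff A {j}) = (\<lambda>k. (if k = j then - 1 else 1) * rademacher A k)" for A
    by (rule ext)
  moreover have "(\<Prod>k\<in>S. if k = j then - 1 else 1) = rademacher S j"
    using assms(2) by (simp add: rademacher_def)
  ultimately have p: "prod (rademacher (sym_diff A {j})) S = rademacher S j * prod (rademacher A) S" for A
    by (simp only: prod.distrib)
  have "walsh I (\<lambda>A. f (sym_diff A {j})) S
      = (\<Sum>A\<in>Pow I. prod (rademacher (sym_diff A {j})) S * f A)"
    unfolding walsh_def
  proof (rule sum.reindex_bij_witness[where i = "\<lambda>A. sym_diff A {j}" and j = "\<lambda>A. sym_diff A {j}"])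
    fix A
    have "sym_diff (sym_diff A {j}) {j} = A" by blast
    then show "sym_diff (sym_diff A {j}) {j} = A" "sym_diff (sym_diff A {j}) {j} = A"
      "prod (rademacher (sym_diff (sym_diff A {j}) {j})) S * f (sym_diff A {j})
        = prod (rademacher A) S * f (sym_diff A {j})"
      by (simp_all only:)
  qed (use assms in blast)+
  also have "\<dots> = rademacher S j * walsh I f S"
    unfolding walsh_def p sum_distrib_left by (simp only: mult.assoc)
  finally show ?thesis .
qed

lemma walsh_even:
  assumes "finite I" and even: "\<And>A. A \<subseteq> I \<Longrightarrow> f (I - A) = f A"
    and S: "S \<subseteq> I" "odd (card S)"
  shows "walsh I f S = 0"
proof -
  have "finite S" using S(1) assms(1) by (rule finite_subset)
  have neg: "prod (rademacher (I - A)) S = - prod (rademacher A) S" for A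
  proof -
    have "prod (rademacher (I - A)) S = (\<Prod>k\<in>S. - 1 * rademacher A k)"
      by (rule prod.cong) (use S(1) in \<open>auto simp: rademacher_def\<close>)
    also have "\<dots> = (- 1) ^ card S * prod (rademacher A) S"
      by (simp only: prod.distrib prod_constant)
    also have "\<dots> = - prod (rademacher A) S" using S(2) by simp
    finally show ?thesis .
  qed
  have "walsh I f S = (\<Sum>A\<in>Pow I. prod (rademacher (I - A)) S * f (I - A))"
    unfolding walsh_def
  proof (rule sum.reindex_bij_witness[where i = "\<lambda>A. I - A" and j = "\<lambda>A. I - A"])
    fix A assume "A \<in> Pow I"
    then have "I - (I - A) = A" by auto
    then show "I - (I - A) = A" "I - (I - A) = A"
      "prod (rademacher (I - (I - A))) S * f (I - (I - A)) = prod (rademacher A) S * f A"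
      by simp_all
  qed auto
  also have "\<dots> = (\<Sum>A\<in>Pow I. - (prod (rademacher A) S * f A))"
    by (rule sum.cong) (simp_all add: neg even)
  also have "\<dots> = - walsh I f S" by (simp add: walsh_def sum_negf)
  finally show ?thesis by simp
qed

section \<open>The Kahane-Khintchine inequality with constant \<open>\<surd>2\<close>\<close>

lemma sum_rademacher:
  assumes "finite I" "A \<subseteq> I"
  shows "(\<Sum>j\<in>I. rademacher A j) = real (card I) - 2 * real (card A)"
proof -
  have "(\<Sum>j\<in>I. rademacher A j) = (\<Sum>j\<in>I. 1 - 2 * (if j \<in> A then 1 else 0))"
    by (rule sum.cong) (auto simp: rademacher_def)
  also have "\<dots> = real (card I) - 2 * (\<Sum>j\<in>I. if j \<in> A then 1 else 0)"
    by (simp add: sum_subtractf sum_distrib_left[symmetric] del: sum.delta)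
  also have "(\<Sum>j\<in>I. if j \<in> A then 1 else (0::real)) = real (card A)"
    using assms by (simp add: sum.If_cases Int_absorb1)
  finally show ?thesis .
qed

text \<open>
  If \<open>X A\<close> denotes the signed sum at the point \<open>A\<close>, the sum of \<open>X\<close> over the neighbours of \<open>A\<close> is
  exactly \<open>(card I - 2) *\<^sub>R X A\<close>, because each vector changes sign at one neighbour only. The triangle
  inequality does the rest.
\<close>

lemma rademacher_neighbour_sum:
  fixes z :: "'i \<Rightarrow> 'v::real_normed_vector"
  assumes "finite I"
  shows "(real (card I) - 2) * norm (\<Sum>k\<in>I. rademacher A k *\<^sub>R z k)
    \<le> (\<Sum>j\<in>I. norm (\<Sum>k\<in>I. rademacher (sym_diff A {j}) k *\<^sub>R z k))"
proof -
  define X where "X A = (\<Sum>k\<in>I. rademacher A k *\<^sub>R z k)" for A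
  have fl: "X (sym_diff A {j}) = X A - (2 * rademacher A j) *\<^sub>R z j" if "j \<in> I" for j
  proof -
    have "X (sym_diff A {j}) = (\<Sum>k\<in>I. rademacher A k *\<^sub>R z k - (if k = j then (2 * rademacher A j) *\<^sub>R z j else 0))"
      unfolding X_def by (rule sum.cong) (auto simp: rademacher_def scaleR_2 algebra_simps)
    then show ?thesis using that assms by (simp add: sum_subtractf X_def)
  qed
  have "(\<Sum>j\<in>I. X (sym_diff A {j})) = (\<Sum>j\<in>I. X A - 2 *\<^sub>R (rademacher A j *\<^sub>R z j))"
    by (rule sum.cong) (simp_all add: fl)
  also have "\<dots> = (real (card I) - 2) *\<^sub>R X A"
    by (simp only: sum_subtractf scaleR_sum_right[symmetric] X_def[symmetric] sum_constant_scaleR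
        scaleR_left_diff_distrib)
  finally have "norm ((real (card I) - 2) *\<^sub>R X A) \<le> (\<Sum>j\<in>I. norm (X (sym_diff A {j})))"
    by (metis norm_sum)
  moreover have "(real (card I) - 2) * norm (X A) \<le> norm ((real (card I) - 2) *\<^sub>R X A)"
    by (simp add: mult_right_mono)
  ultimately show ?thesis unfolding X_def by linarith
qed

text \<open>
  The argument of Latala and Oleszkiewicz. Pairing \<open>f\<close> with the sum of \<open>f\<close> over neighbours,
  \<open>rademacher_neighbour_sum\<close> bounds the pairing from below by \<open>(card I - 2) * \<Sum>f\<^sup>2\<close>, while in
  Fourier terms it is \<open>\<Sum>S. (card I - 2 * card S) * (W S)\<^sup>2\<close>. Since \<open>f\<close> is even, all \<open>S\<close> that occur
  apart from the empty set have at least two elements, so \<open>W {}\<close> must carry at least half of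
  \<open>\<Sum>S. (W S)\<^sup>2\<close>. For a function that is not even the sets with one element would spoil the
  argument.
\<close>

lemma kahane_khintchine:
  fixes z :: "'i \<Rightarrow> 'v::real_normed_vector"
  assumes "finite I"
  defines "f \<equiv> \<lambda>A. norm (\<Sum>j\<in>I. rademacher A j *\<^sub>R z j)"
  shows "2 ^ card I * (\<Sum>A\<in>Pow I. (f A)\<^sup>2) \<le> 2 * (\<Sum>A\<in>Pow I. f A)\<^sup>2"
proof -
  define W where "W = walsh I f"
  define n where "n = real (card I)"
  have W2: "(\<Sum>S\<in>Pow I. (W S)\<^sup>2) = 2 ^ card I * (\<Sum>A\<in>Pow I. (f A)\<^sup>2)"
    using walsh_parseval[OF assms(1), of f f] by (simp add: W_def power2_eq_square)
  have even: "f (I - A) = f A" for A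
  proof -
    have "(\<Sum>j\<in>I. rademacher (I - A) j *\<^sub>R z j) = (\<Sum>j\<in>I. - (rademacher A j *\<^sub>R z j))"
      by (rule sum.cong) (auto simp: rademacher_def)
    then show ?thesis by (simp add: f_def sum_negf)
  qed
  have W_odd: "W S = 0" if "S \<subseteq> I" "odd (card S)" for S
    unfolding W_def using assms(1) even that by (rule walsh_even)
  have "(\<Sum>S\<in>Pow I. (n - 2) * (W S)\<^sup>2) = 2 ^ card I * (\<Sum>A\<in>Pow I. f A * ((n - 2) * f A))"
  proof -
    have "(\<Sum>A\<in>Pow I. f A * ((n - 2) * f A)) = (n - 2) * (\<Sum>A\<in>Pow I. (f A)\<^sup>2)"
      by (simp add: sum_distrib_left power2_eq_square mult_ac)
    then show ?thesis by (simp only: sum_distrib_left[symmetric] W2 mult_ac)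
  qed
  also have "\<dots> \<le> 2 ^ card I * (\<Sum>A\<in>Pow I. f A * (\<Sum>j\<in>I. f (sym_diff A {j})))"
    unfolding f_def n_def
    by (intro mult_left_mono sum_mono rademacher_neighbour_sum[OF assms(1)]) auto
  also have "\<dots> = (\<Sum>j\<in>I. 2 ^ card I * (\<Sum>A\<in>Pow I. f A * f (sym_diff A {j})))"
    by (simp only: sum_distrib_left) (rule sum.swap)
  also have "\<dots> = (\<Sum>j\<in>I. \<Sum>S\<in>Pow I. rademacher S j * (W S)\<^sup>2)"
  proof (rule sum.cong[OF refl])
    fix j assume "j \<in> I"
    then have "walsh I (\<lambda>A. f (sym_diff A {j})) S = rademacher S j * W S" if "S \<in> Pow I" for S
      unfolding W_def using that assms(1) by (auto intro!: walsh_flip intro: finite_subset)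
    then show "2 ^ card I * (\<Sum>A\<in>Pow I. f A * f (sym_diff A {j}))
        = (\<Sum>S\<in>Pow I. rademacher S j * (W S)\<^sup>2)"
      unfolding walsh_parseval[OF assms(1), symmetric] W_def[symmetric]
      by (intro sum.cong refl) (simp only: power2_eq_square mult_ac)
  qed
  also have "\<dots> = (\<Sum>S\<in>Pow I. \<Sum>j\<in>I. rademacher S j * (W S)\<^sup>2)"
    by (rule sum.swap)
  also have "\<dots> = (\<Sum>S\<in>Pow I. (n - 2 * real (card S)) * (W S)\<^sup>2)"
    unfolding sum_distrib_right[symmetric] n_def
    by (intro sum.cong refl) (simp add: sum_rademacher[OF assms(1)])
  \<comment> \<open>The coefficient of \<open>(W S)\<^sup>2\<close> is \<open>2 - 2 * card S\<close>: it is \<open>2\<close> for the empty set, and at most \<open>-2\<close> if \<open>card S \<ge> 2\<close>.\<close>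
  finally have "0 \<le> (\<Sum>S\<in>Pow I. (n - 2 * real (card S)) * (W S)\<^sup>2 - (n - 2) * (W S)\<^sup>2)"
    by (simp add: sum_subtractf)
  also have "\<dots> \<le> (\<Sum>S\<in>Pow I. (if S = {} then 4 * (W {})\<^sup>2 else 0) - 2 * (W S)\<^sup>2)"
  proof (rule sum_mono)
    fix S assume "S \<in> Pow I"
    then have S: "S \<subseteq> I" "finite S" using assms(1) finite_subset by auto
    show "(n - 2 * real (card S)) * (W S)\<^sup>2 - (n - 2) * (W S)\<^sup>2
        \<le> (if S = {} then 4 * (W {})\<^sup>2 else 0) - 2 * (W S)\<^sup>2"
    proof (cases "S = {} \<or> odd (card S)")
      case True
      then show ?thesis
        using W_odd[OF S(1)] by (auto simp: algebra_simps)
    next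
      case False
      with S have "card S \<noteq> 0" "card S \<noteq> 1" by auto
      then have "real (card S) \<ge> 2" by linarith
      then have "(2 - real (card S)) * (W S)\<^sup>2 \<le> 0"
        by (simp add: mult_nonpos_nonneg)
      with False show ?thesis by (simp add: algebra_simps)
    qed
  qed
  also have "\<dots> = 4 * (W {})\<^sup>2 - 2 * (\<Sum>S\<in>Pow I. (W S)\<^sup>2)"
    using assms(1) by (simp add: sum_subtractf sum_distrib_left[symmetric])
  finally have "(\<Sum>S\<in>Pow I. (W S)\<^sup>2) \<le> 2 * (W {})\<^sup>2" by simp
  moreover have "W {} = (\<Sum>A\<in>Pow I. f A)"
    by (simp only: W_def walsh_def prod.empty mult_1_left)
  ultimately show ?thesis by (simp only: W2)
qed

text \<open>
  This is \<open>walsh_orthogonality\<close> with the roles of points and characters exchanged: the character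
  of \<open>S\<close> at the point \<open>A\<close> is \<open>(-1) ^ card (A \<inter> S)\<close>, which is symmetric in \<open>A\<close> and \<open>S\<close>.
\<close>

lemma rademacher_covariance:
  assumes "finite I" "j \<in> I" "k \<in> I"
  shows "(\<Sum>A\<in>Pow I. rademacher A j * rademacher A k) = (if j = k then 2 ^ card I else 0)"
proof -
  have "prod (rademacher {i}) A = rademacher A i" if "A \<in> Pow I" for A and i :: 'a
  proof -
    have fin: "finite A" using that assms(1) finite_subset by auto
    have "prod (rademacher {i}) A = (\<Prod>k\<in>A. if k = i then - 1 else 1)"
      by (rule prod.cong) (simp_all add: rademacher_def)
    also have "\<dots> = rademacher A i"
      unfolding prod.delta[OF fin] rademacher_def by (rule refl)
    finally show ?thesis .
  qed
  then have "(\<Sum>A\<in>Pow I. rademacher A j * rademacher A k)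
      = (\<Sum>A\<in>Pow I. prod (rademacher {j}) A * prod (rademacher {k}) A)"
    by (intro sum.cong refl) (simp only:)
  then show ?thesis
    using walsh_orthogonality[of I "{j}" "{k}"] assms by simp
qed

lemma rademacher_second_moment:
  fixes z :: "'i \<Rightarrow> 'v::real_inner"
  assumes "finite I"
  shows "(\<Sum>A\<in>Pow I. (norm (\<Sum>j\<in>I. rademacher A j *\<^sub>R z j))\<^sup>2)
    = 2 ^ card I * (\<Sum>j\<in>I. (norm (z j))\<^sup>2)"
proof -
  have "(\<Sum>A\<in>Pow I. (norm (\<Sum>j\<in>I. rademacher A j *\<^sub>R z j))\<^sup>2)
      = (\<Sum>A\<in>Pow I. \<Sum>j\<in>I. \<Sum>k\<in>I. inner (z j) (z k) * (rademacher A j * rademacher A k))"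
    unfolding power2_norm_eq_inner inner_sum_left unfolding inner_sum_right
    by (simp add: mult_ac)
  also have "\<dots> = (\<Sum>j\<in>I. \<Sum>A\<in>Pow I. \<Sum>k\<in>I. inner (z j) (z k) * (rademacher A j * rademacher A k))"
    by (rule sum.swap)
  also have "\<dots> = (\<Sum>j\<in>I. \<Sum>k\<in>I. \<Sum>A\<in>Pow I. inner (z j) (z k) * (rademacher A j * rademacher A k))"
    by (intro sum.cong refl sum.swap)
  also have "\<dots> = (\<Sum>j\<in>I. \<Sum>k\<in>I. if j = k then inner (z j) (z k) * 2 ^ card I else 0)"
    unfolding sum_distrib_left[symmetric]
    by (intro sum.cong refl) (simp add: rademacher_covariance[OF assms])
  also have "\<dots> = 2 ^ card I * (\<Sum>j\<in>I. (norm (z j))\<^sup>2)"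
    using assms by (simp add: sum_distrib_left power2_norm_eq_inner mult_ac)
  finally show ?thesis .
qed

lemma khintchine:
  fixes z :: "'i \<Rightarrow> 'v::real_inner"
  assumes "finite I"
  shows "2 ^ card I * sqrt (\<Sum>j\<in>I. (norm (z j))\<^sup>2)
    \<le> sqrt 2 * (\<Sum>A\<in>Pow I. norm (\<Sum>j\<in>I. rademacher A j *\<^sub>R z j))"
    (is "?N * sqrt ?s \<le> sqrt 2 * ?m")
proof (rule power2_le_imp_le)
  have "(?N * sqrt ?s)\<^sup>2 = ?N * (?N * ?s)"
    by (simp only: power_mult_distrib real_sqrt_pow2[OF sum_nonneg[OF zero_le_power2]])
      (simp only: power2_eq_square mult.assoc)
  also have "\<dots> \<le> 2 * ?m\<^sup>2"
    using kahane_khintchine[OF assms, of z] unfolding rademacher_second_moment[OF assms] .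
  also have "\<dots> = (sqrt 2 * ?m)\<^sup>2"
    by (simp only: power_mult_distrib real_sqrt_pow2[OF zero_le_numeral])
  finally show "(?N * sqrt ?s)\<^sup>2 \<le> (sqrt 2 * ?m)\<^sup>2" .
qed (simp add: sum_nonneg)

section \<open>A separation principle for convex sets\<close>

text \<open>
  The hypothesis says that no hyperplane orthogonal to \<open>a - c\<close> strictly separates \<open>a\<close> from \<open>C\<close>.
  It need only be tested in these directions: if \<open>c\<close> nearly minimizes the distance to \<open>a\<close>, moving from
  \<open>c\<close> a little towards the point \<open>d\<close> decreases the distance by a definite amount. Almost
  minimizers serve because the distance need not be attained.
\<close>

lemma closure_convex_if_support:
  fixes a :: "'v::real_inner"
  assumes "convex C" "bounded C" "C \<noteq> {}"
    and support: "\<And>c. c \<in> C \<Longrightarrow> \<exists>d\<in>C. inner (a - c) a \<le> inner (a - c) d"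
  shows "a \<in> closure C"
proof (rule ccontr)
  have norm_sq: "(norm (p - t *\<^sub>R q))\<^sup>2 = (norm p)\<^sup>2 - 2 * t * inner p q + t\<^sup>2 * (norm q)\<^sup>2"
    for p q :: 'v and t
    unfolding power2_norm_eq_inner
    by (simp add: inner_diff_left inner_diff_right inner_commute[of q p] power2_eq_square right_diff_distrib)
  assume "a \<notin> closure C"
  then obtain e where e: "e > 0" "\<And>c. c \<in> C \<Longrightarrow> e \<le> norm (a - c)"
    unfolding closure_approachable by (force simp: dist_norm norm_minus_commute)
  obtain D where D: "D > 0" "\<And>c. c \<in> C \<Longrightarrow> norm c \<le> D"
    using assms(2) unfolding bounded_pos by auto
  define m where "m = Inf ((\<lambda>c. (norm (a - c))\<^sup>2) ` C)"
  have bdd: "bdd_below ((\<lambda>c. (norm (a - c))\<^sup>2) ` C)" by (rule bdd_belowI[of _ 0]) auto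
  have m_le: "m \<le> (norm (a - c))\<^sup>2" if "c \<in> C" for c
    unfolding m_def using that by (intro cINF_lower bdd)
  have "e\<^sup>2 \<le> m"
    unfolding m_def using assms(3) e by (intro cINF_greatest power_mono) auto
  with e(1) have m: "m > 0" by (metis less_le_trans zero_less_power)
  \<comment> \<open>The step length for which the first-order gain \<open>2 * t * m\<close> exceeds the second-order loss by at least \<open>t * m\<close>.\<close>
  define t where "t = min 1 (m / (2 * D)\<^sup>2)"
  have t: "t > 0" "t \<le> 1" "t * (2 * D)\<^sup>2 \<le> m"
    using m D(1) by (auto simp: t_def min_def field_simps)
  have "Inf ((\<lambda>c. (norm (a - c))\<^sup>2) ` C) < m + t * m" unfolding m_def[symmetric] using t(1) m by simp
  then obtain c where c: "c \<in> C" "(norm (a - c))\<^sup>2 < m + t * m"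
    by (subst (asm) cINF_less_iff) (use assms(3) bdd in auto)
  obtain d where d: "d \<in> C" "inner (a - c) a \<le> inner (a - c) d" using support[OF c(1)] by blast
  have "(1 - t) *\<^sub>R c + t *\<^sub>R d \<in> C"
    using assms(1) c(1) d(1) t by (intro convexD) auto
  then have "m \<le> (norm (a - ((1 - t) *\<^sub>R c + t *\<^sub>R d)))\<^sup>2" by (rule m_le)
  also have "a - ((1 - t) *\<^sub>R c + t *\<^sub>R d) = (a - c) - t *\<^sub>R (d - c)" by (simp add: algebra_simps)
  also have "(norm \<dots>)\<^sup>2 = (norm (a - c))\<^sup>2 - 2 * t * inner (a - c) (d - c) + t\<^sup>2 * (norm (d - c))\<^sup>2"
    by (rule norm_sq)
  finally have 1: "m \<le> (norm (a - c))\<^sup>2 - 2 * t * inner (a - c) (d - c) + t\<^sup>2 * (norm (d - c))\<^sup>2" .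
  have "m \<le> inner (a - c) (a - c)" using m_le[OF c(1)] by (simp add: power2_norm_eq_inner)
  also have "\<dots> \<le> inner (a - c) (d - c)" using d(2) by (simp add: inner_diff_right)
  finally have 2: "2 * t * m \<le> 2 * t * inner (a - c) (d - c)" using t(1) by simp
  have "norm (d - c) \<le> 2 * D" using D(2)[OF c(1)] D(2)[OF d(1)] norm_triangle_ineq4[of d c] by linarith
  then have "t * (norm (d - c))\<^sup>2 \<le> t * (2 * D)\<^sup>2" using t(1) by (intro mult_left_mono power_mono) auto
  then have "t * (norm (d - c))\<^sup>2 \<le> m" using t(3) by (rule order_trans)
  then have "t * (t * (norm (d - c))\<^sup>2) \<le> t * m" using t(1) by (intro mult_left_mono) auto
  with 1 2 c(2) show False by (simp add: power2_eq_square mult_ac)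
qed

section \<open>Orthonormal systems over the scalar field\<close>

definition hdot :: "'k::{real_normed_field,real_inner} ^ 'm \<Rightarrow> 'k ^ 'm \<Rightarrow> 'k"
  where "hdot u v = (\<Sum>j\<in>UNIV. conjugate (u $ j) * v $ j)"

lemma hdot_add_right: "hdot u (v + w) = hdot u v + hdot u w"
  by (simp add: hdot_def distrib_left sum.distrib)

lemma hdot_scale_right: "hdot u (c *s v) = c * hdot u v"
  by (simp add: hdot_def sum_distrib_left mult_ac)

lemma hdot_0_right [simp]: "hdot u 0 = 0"
  by (simp add: hdot_def)

lemma hdot_diff_right: "hdot u (v - w) = hdot u v - hdot u w"
  by (simp add: hdot_def right_diff_distrib sum_subtractf)

lemma hdot_sum_right: "hdot u (\<Sum>i\<in>A. f i) = (\<Sum>i\<in>A. hdot u (f i))"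
  by (induction A rule: infinite_finite_induct) (simp_all add: hdot_add_right)

lemma conjugate_hdot: "conjugate (hdot u v) = hdot v u"
  by (simp add: hdot_def conjugate_sum conjugate_mult mult.commute)

lemma norm_hdot_commute: "norm (hdot u v) = norm (hdot v u)"
  by (metis conjugate_hdot norm_conjugate)

lemma inner_eq_hdot: "inner u v = inner 1 (hdot u v)"
  unfolding inner_vec_def hdot_def inner_sum_right by (subst inner_eq_conjugate_mult) (rule refl)

lemma hdot_self: "hdot v v = of_real ((norm v)\<^sup>2)"
proof -
  have "hdot v v = of_real (\<Sum>j\<in>UNIV. (norm (v $ j))\<^sup>2)"
    unfolding hdot_def conjugate_mult_self of_real_sum by (rule refl)
  also have "(\<Sum>j\<in>UNIV. (norm (v $ j))\<^sup>2) = (norm v)\<^sup>2"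
    unfolding norm_vec_def L2_set_def by (rule real_sqrt_pow2[symmetric]) (simp add: sum_nonneg)
  finally show ?thesis .
qed

lemma of_real_smult_vec: "of_real c *s v = c *\<^sub>R (v :: 'k::real_normed_field ^ 'm)"
  unfolding vec_eq_iff vector_smult_component vector_scaleR_component
  by (rule allI) (simp only: scaleR_conv_of_real)

lemma norm_smult_vec: "norm (c *s v) = norm c * norm (v :: 'k::real_normed_field ^ 'm)"
  unfolding norm_vec_def by (simp add: norm_mult L2_set_right_distrib)

definition orthonormal :: "('k::{real_normed_field,real_inner} ^ 'm) set \<Rightarrow> bool"
  where "orthonormal U \<longleftrightarrow> finite U \<and> (\<forall>u\<in>U. \<forall>v\<in>U. hdot u v = (if u = v then 1 else 0))"

lemma orthonormal_coefficient:
  assumes "orthonormal U" "u \<in> U"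
  shows "hdot u (\<Sum>w\<in>U. c w *s w) = c u"
proof -
  have "hdot u (\<Sum>w\<in>U. c w *s w) = (\<Sum>w\<in>U. if u = w then c w else 0)"
    unfolding hdot_sum_right hdot_scale_right
    by (rule sum.cong) (use assms in \<open>simp_all add: orthonormal_def\<close>)
  also have "\<dots> = c u" using assms by (simp add: orthonormal_def)
  finally show ?thesis .
qed

lemma orthonormal_expansion:
  assumes U: "orthonormal U" and v: "v \<in> vec.span U"
  shows "(\<Sum>u\<in>U. hdot u v *s u) = v"
proof -
  have "finite U" using U by (simp add: orthonormal_def)
  then obtain c where c: "v = (\<Sum>u\<in>U. c u *s u)" using v vec.span_finite by blast
  have "hdot u v = c u" if "u \<in> U" for u
    unfolding c using U that by (rule orthonormal_coefficient)
  then show ?thesis unfolding c by (intro sum.cong refl) simp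
qed

lemma orthonormal_norm_sum:
  assumes U: "orthonormal U"
  shows "(norm (\<Sum>u\<in>U. c u *s u))\<^sup>2 = (\<Sum>u\<in>U. (norm (c u))\<^sup>2)"
proof -
  define v where "v = (\<Sum>u\<in>U. c u *s u)"
  have cu: "hdot v u = conjugate (c u)" if "u \<in> U" for u
    using orthonormal_coefficient[OF U that, of c] unfolding v_def[symmetric]
    by (metis conjugate_hdot)
  have "hdot v v = (\<Sum>u\<in>U. c u * hdot v u)"
    by (subst (2) v_def) (simp only: hdot_sum_right hdot_scale_right)
  also have "\<dots> = (\<Sum>u\<in>U. of_real ((norm (c u))\<^sup>2))"
    by (rule sum.cong[OF refl]) (simp only: cu conjugate_mult_self mult.commute[of _ "conjugate _"])
  finally have "of_real ((norm v)\<^sup>2) = (of_real (\<Sum>u\<in>U. (norm (c u))\<^sup>2) :: 'a)"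
    by (simp only: hdot_self of_real_sum)
  then show ?thesis unfolding v_def by (simp only: of_real_eq_iff)
qed

lemma gram_schmidt:
  fixes B :: "('k::{real_normed_field,real_inner} ^ 'm) set"
  assumes "finite B"
  shows "\<exists>U. orthonormal U \<and> card U \<le> card B \<and> B \<subseteq> vec.span U"
  using assms
proof induction
  case empty
  show ?case by (intro exI[of _ "{}"]) (simp add: orthonormal_def)
next
  case (insert v B)
  then obtain U where U: "orthonormal U" "card U \<le> card B" "B \<subseteq> vec.span U" by blast
  have fin: "finite U" using U(1) by (simp add: orthonormal_def)
  define p where "p = (\<Sum>u\<in>U. hdot u v *s u)"
  define w where "w = v - p"
  have p: "p \<in> vec.span U"
    unfolding p_def by (intro vec.span_sum vec.span_scale vec.span_base)
  show ?case
  proof (cases "w = 0")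
    case True
    then have "v \<in> vec.span U" using p by (simp add: w_def)
    with U insert show ?thesis by (intro exI[of _ U]) auto
  next
    case False
    define e where "e = of_real (1 / norm w) *s w"
    have uw: "hdot u w = 0" if "u \<in> U" for u
      using orthonormal_coefficient[OF U(1) that, of "\<lambda>u. hdot u v"]
      by (simp add: w_def hdot_diff_right p_def)
    then have ue: "hdot u e = 0" "hdot e u = 0" if "u \<in> U" for u
    proof -
      show "hdot u e = 0" using uw[OF that] by (simp add: e_def hdot_scale_right)
      then show "hdot e u = 0" by (metis conjugate_hdot conjugate_0)
    qed
    have "norm e = 1" using False by (simp add: e_def norm_smult_vec norm_divide)
    then have ee: "hdot e e = 1" by (simp add: hdot_self)
    with ue have "e \<notin> U" by fastforce
    have "w = of_real (norm w) *s e"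
      using False by (simp add: e_def flip: of_real_mult)
    then have "w \<in> vec.span (insert e U)"
      by (metis insertI1 vec.span_base vec.span_scale)
    moreover have mono: "vec.span U \<subseteq> vec.span (insert e U)"
      by (intro vec.span_mono) auto
    ultimately have "v \<in> vec.span (insert e U)"
      using p vec.span_add[of w "insert e U" p] by (auto simp: w_def)
    moreover have "orthonormal (insert e U)"
      using U(1) ue ee \<open>e \<notin> U\<close> by (auto simp: orthonormal_def)
    ultimately show ?thesis
      using U mono insert fin \<open>e \<notin> U\<close> by (intro exI[of _ "insert e U"]) auto
  qed
qed

text \<open>
  The rank is the dimension of the row space, and what is needed concerns the columns.
  Expanding the rows in a basis \<open>B\<close> of \<open>rank T\<close> vectors factors \<open>T\<close> through a space of that
  dimension, so the columns are combinations of the coefficient vectors \<open>g b\<close>.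
\<close>

lemma columns_in_span_of_rank:
  fixes T :: "'k::{real_normed_field,real_inner} ^ 'n ^ 'm"
  shows "\<exists>U :: ('k ^ 'm) set. orthonormal U \<and> card U \<le> rank T \<and> (\<forall>i. column i T \<in> vec.span U)"
proof -
  obtain B where B: "B \<subseteq> rows T" "rows T \<subseteq> vec.span B" "card B = rank T"
    unfolding row_rank_def_gen using vec.basis_exists[of "rows T"] by metis
  have "finite (rows T)" by (simp add: rows_def full_SetCompr_eq)
  then have fin: "finite B" using B(1) by (rule finite_subset[rotated])
  have "\<exists>c. row j T = (\<Sum>b\<in>B. c b *s b)" for j
  proof -
    have "row j T \<in> vec.span B" using B(2) by (auto simp: rows_def)
    then show ?thesis using vec.span_finite[OF fin] by blast
  qed
  then obtain c where c: "\<And>j. row j T = (\<Sum>b\<in>B. c j b *s b)" by metis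
  define g where "g b = (\<chi> j. c j b)" for b
  have "column i T = (\<Sum>b\<in>B. (b $ i) *s g b)" for i
  proof -
    have "T $ j $ i = (\<Sum>b\<in>B. c j b * b $ i)" for j
      using arg_cong[OF c[of j], of "\<lambda>v. v $ i"] by (simp add: row_def)
    then show ?thesis by (simp add: column_def vec_eq_iff g_def mult.commute)
  qed
  then have col: "column i T \<in> vec.span (g ` B)" for i
    by (simp only:) (intro vec.span_sum vec.span_scale vec.span_base imageI)
  obtain U where U: "orthonormal U" "card U \<le> card (g ` B)" "g ` B \<subseteq> vec.span U"
    using gram_schmidt[of "g ` B"] fin by blast
  have "column i T \<in> vec.span U" for i
    using col[of i] vec.span_minimal[OF U(3) vec.subspace_span] by blast
  moreover have "card U \<le> rank T"
    using U(2) card_image_le[OF fin, of g] B(3) by simp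
  ultimately show ?thesis using U(1) by blast
qed

section \<open>Convex combinations of cube vertices\<close>

definition cube_vertex :: "('k::{real_normed_field,real_inner} ^ 'm) set \<Rightarrow> ('k ^ 'm) set \<Rightarrow> 'k ^ 'm"
  where "cube_vertex U A = (\<Sum>u\<in>U. of_real (rademacher A u) *s u)"

lemma norm_cube_vertex:
  assumes "orthonormal U"
  shows "norm (cube_vertex U A) = sqrt (card U)"
proof -
  have "(norm (cube_vertex U A))\<^sup>2 = (\<Sum>u\<in>U. 1)"
    unfolding cube_vertex_def orthonormal_norm_sum[OF assms]
    by (rule sum.cong) (auto simp: rademacher_def)
  then show ?thesis by (simp add: real_sqrt_unique)
qed

text \<open>
  This is the dual form of Khintchine's inequality. The averages of the vertices with scalar
  weights of norm at most \<open>\<surd>2 * norm a\<close> form a bounded convex set; in a direction \<open>z\<close> of the span,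
  the best weights align the phase of each \<open>hdot z (cube_vertex U A)\<close>, and \<open>khintchine\<close> says that
  the resulting average has inner product at least \<open>norm a * norm z \<ge> inner z a\<close> with \<open>z\<close>. Hence
  the set reaches \<open>a\<close> by \<open>closure_convex_if_support\<close>, up to an arbitrarily small error.
\<close>

lemma approximate_by_cube_vertices:
  assumes U: "orthonormal U" and a: "a \<in> vec.span U" and "0 < e"
  shows "\<exists>x. (\<forall>A. norm (x A) \<le> sqrt 2 * norm a) \<and>
    norm (a - (\<Sum>A\<in>Pow U. x A *s ((1 / 2 ^ card U) *\<^sub>R cube_vertex U A))) < e"
proof -
  have fin: "finite U" using U by (simp add: orthonormal_def)
  define q where "q A = (1 / 2 ^ card U) *\<^sub>R cube_vertex U A" for A
  define avg where "avg x = (\<Sum>A\<in>Pow U. x A *s q A)" for x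
  define b where "b = sqrt 2 * norm a"
  define C where "C = avg ` {x. \<forall>A. norm (x A) \<le> b}"
  have q_span: "q A \<in> vec.span U" for A
    unfolding q_def cube_vertex_def of_real_smult_vec[symmetric]
    by (intro vec.span_sum vec.span_scale vec.span_base)
  have "convex C"
  proof (rule convexI)
    fix c d and s t :: real
    assume "c \<in> C" "d \<in> C" and st: "0 \<le> s" "0 \<le> t" "s + t = 1"
    then obtain x y where x: "\<And>A. norm (x A) \<le> b" "c = avg x" and y: "\<And>A. norm (y A) \<le> b" "d = avg y"
      unfolding C_def by auto
    have "norm (s *\<^sub>R x A + t *\<^sub>R y A) \<le> b" for A
    proof -
      have "norm (s *\<^sub>R x A + t *\<^sub>R y A) \<le> s * norm (x A) + t * norm (y A)"
        using norm_triangle_ineq[of "s *\<^sub>R x A" "t *\<^sub>R y A"] st by simp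
      also have "\<dots> \<le> s * b + t * b" using x y st by (intro add_mono mult_left_mono) auto
      also have "\<dots> = b" using st by (metis distrib_right mult_1_left)
      finally show ?thesis .
    qed
    moreover have "s *\<^sub>R c + t *\<^sub>R d = avg (\<lambda>A. s *\<^sub>R x A + t *\<^sub>R y A)"
      unfolding x y avg_def scaleR_sum_right sum.distrib[symmetric]
      by (intro sum.cong refl) (simp add: vec_eq_iff distrib_right)
    ultimately show "s *\<^sub>R c + t *\<^sub>R d \<in> C" unfolding C_def by blast
  qed
  moreover have "bounded C"
  proof -
    have "norm c \<le> (\<Sum>A\<in>Pow U. b * norm (q A))" if "c \<in> C" for c
    proof -
      from that obtain x where x: "\<And>A. norm (x A) \<le> b" "c = avg x" unfolding C_def by auto
      show ?thesis unfolding x avg_def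
        by (intro sum_norm_le) (simp add: norm_smult_vec mult_right_mono x)
    qed
    then show ?thesis unfolding bounded_iff by blast
  qed
  moreover have "C \<noteq> {}"
  proof -
    have "avg (\<lambda>_. 0) \<in> C" unfolding C_def by (auto simp: b_def)
    then show ?thesis by blast
  qed
  moreover have "\<exists>d\<in>C. inner (a - c) a \<le> inner (a - c) d" if "c \<in> C" for c
  proof -
    define z where "z = a - c"
    have "z \<in> vec.span U"
      using that a q_span unfolding z_def C_def avg_def
      by (auto intro!: vec.span_diff vec.span_sum vec.span_scale)
    then have z: "z = (\<Sum>u\<in>U. hdot u z *s u)" using orthonormal_expansion[OF U] by simp
    define h where "h A = hdot z (cube_vertex U A)" for A
    \<comment> \<open>Weights of norm \<open>b\<close> whose phase turns each product \<open>x A * h A\<close> into a nonnegative real number.\<close>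
    define x where "x A = (if h A = 0 then 0 else of_real (b / norm (h A)) * conjugate (h A))" for A
    have b0: "b \<ge> 0" by (simp add: b_def)
    have "norm (x A) \<le> b" for A using b0 by (simp add: x_def norm_mult norm_divide)
    then have "avg x \<in> C" unfolding C_def by blast
    moreover have "inner z a \<le> inner z (avg x)"
    proof -
      have hx: "x A * h A = of_real (b * norm (h A))" for A
        by (simp add: x_def mult.assoc conjugate_mult_self power2_eq_square)
      have h_sum: "h A = (\<Sum>u\<in>U. rademacher A u *\<^sub>R hdot z u)" for A
        unfolding h_def cube_vertex_def hdot_sum_right hdot_scale_right
        by (simp only: scaleR_conv_of_real)
      have "(norm z)\<^sup>2 = (\<Sum>u\<in>U. (norm (hdot z u))\<^sup>2)"
        by (subst z) (simp only: orthonormal_norm_sum[OF U] norm_hdot_commute[of z])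
      then have nz: "norm z = sqrt (\<Sum>u\<in>U. (norm (hdot z u))\<^sup>2)"
        by (metis norm_ge_zero real_sqrt_unique)
      have kh: "2 ^ card U * norm z \<le> sqrt 2 * (\<Sum>A\<in>Pow U. norm (h A))"
        unfolding h_sum nz using fin by (rule khintchine)
      have "hdot z (avg x) = (\<Sum>A\<in>Pow U. of_real (b / 2 ^ card U * norm (h A)))"
        unfolding avg_def hdot_sum_right hdot_scale_right
      proof (rule sum.cong[OF refl])
        fix A
        have "hdot z (q A) = of_real (1 / 2 ^ card U) * h A"
          unfolding q_def h_def of_real_smult_vec[symmetric] hdot_scale_right by (rule refl)
        then have "x A * hdot z (q A) = of_real (1 / 2 ^ card U) * (x A * h A)"
          by (simp only: mult_ac)
        then show "x A * hdot z (q A) = of_real (b / 2 ^ card U * norm (h A))"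
          unfolding hx by (simp flip: of_real_mult)
      qed
      also have "\<dots> = of_real (\<Sum>A\<in>Pow U. b / 2 ^ card U * norm (h A))" by (simp only: of_real_sum)
      finally have "inner z (avg x) = (\<Sum>A\<in>Pow U. b / 2 ^ card U * norm (h A))"
        by (simp only: inner_eq_hdot[of z "avg x"] inner_one_of_real)
      also have "\<dots> = b / 2 ^ card U * (\<Sum>A\<in>Pow U. norm (h A))" by (simp only: sum_distrib_left)
      also have "\<dots> = norm a / 2 ^ card U * (sqrt 2 * (\<Sum>A\<in>Pow U. norm (h A)))" by (simp add: b_def)
      also have "\<dots> \<ge> norm a / 2 ^ card U * (2 ^ card U * norm z)"
        by (rule mult_left_mono[OF kh]) simp
      also have "norm a / 2 ^ card U * (2 ^ card U * norm z) = norm z * norm a" by simp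
      finally show ?thesis using norm_cauchy_schwarz[of z a] by linarith
    qed
    ultimately show ?thesis unfolding z_def by blast
  qed
  ultimately have "a \<in> closure C" by (rule closure_convex_if_support)
  then obtain c where "c \<in> C" "dist c a < e" using \<open>0 < e\<close> unfolding closure_approachable by blast
  then show ?thesis
    unfolding C_def avg_def q_def b_def by (auto simp: dist_norm norm_minus_commute)
qed

section \<open>Nuclear representations\<close>

lemma norm_nth_le_linf_norm: "norm (x $ i) \<le> linf_norm x"
  unfolding linf_norm_def by (rule Max_ge) auto

lemma linf_norm_le:
  assumes "\<And>i. norm (x $ i) \<le> b"
  shows "linf_norm x \<le> b"
  unfolding linf_norm_def using assms by (intro Max.boundedI) auto

lemma linf_norm_nonneg: "0 \<le> linf_norm x"
  using norm_nth_le_linf_norm norm_ge_zero by (rule order_trans[rotated])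

lemma linf_norm_attained: "\<exists>i. linf_norm x = norm (x $ i)"
proof -
  have "linf_norm x \<in> range (\<lambda>i. norm (x $ i))"
    unfolding linf_norm_def by (rule Max_in) auto
  then show ?thesis by blast
qed

lemma nuclear_values_nonneg:
  assumes "v \<in> {\<Sum>k. linf_norm (x k) * norm (y k) | x y.
           (\<lambda>k. tensor (x k) (y k)) sums T \<and> summable (\<lambda>k. linf_norm (x k) * norm (y k))}"
  shows "0 \<le> v"
  using assms by (auto intro!: suminf_nonneg mult_nonneg_nonneg linf_norm_nonneg)

text \<open>
  Nuclear representations are sequences, but the ones constructed below are indexed by arbitrary
  finite sets; an enumeration padded with zeros connects the two.
\<close>

lemma finite_nuclear_representation:
  fixes T :: "'k::real_normed_field ^ 'n ^ 'm"
  assumes "finite I" and T: "T = (\<Sum>i\<in>I. tensor (x i) (y i))"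
  shows "\<exists>x' y'. (\<lambda>k. tensor (x' k) (y' k)) sums T \<and>
    (\<lambda>k. linf_norm (x' k) * norm (y' k)) sums (\<Sum>i\<in>I. linf_norm (x i) * norm (y i))"
proof -
  obtain h where h: "bij_betw h {..<card I} I"
    using ex_bij_betw_nat_finite[OF assms(1)] atLeast0LessThan by metis
  define x' y' where "x' k = (if k < card I then x (h k) else 0)"
    and "y' k = (if k < card I then y (h k) else 0)" for k
  have "(\<lambda>k. tensor (x' k) (y' k)) sums (\<Sum>k<card I. tensor (x' k) (y' k))"
    by (rule sums_finite) (auto simp: x'_def y'_def tensor_def vec_eq_iff)
  also have "(\<Sum>k<card I. tensor (x' k) (y' k)) = (\<Sum>k<card I. tensor (x (h k)) (y (h k)))"
    by (rule sum.cong) (simp_all add: x'_def y'_def)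
  also have "\<dots> = T"
    unfolding T by (rule sum.reindex_bij_betw[OF h])
  finally have 1: "(\<lambda>k. tensor (x' k) (y' k)) sums T" .
  have "(\<lambda>k. linf_norm (x' k) * norm (y' k)) sums (\<Sum>k<card I. linf_norm (x' k) * norm (y' k))"
    by (rule sums_finite) (auto simp: y'_def)
  also have "(\<Sum>k<card I. linf_norm (x' k) * norm (y' k)) = (\<Sum>k<card I. linf_norm (x (h k)) * norm (y (h k)))"
    by (rule sum.cong) (simp_all add: x'_def y'_def)
  also have "\<dots> = (\<Sum>i\<in>I. linf_norm (x i) * norm (y i))"
    by (rule sum.reindex_bij_betw[OF h])
  finally show ?thesis using 1 by blast
qed

lemma nuclear_norm_le_finite_sum:
  fixes T :: "'k::real_normed_field ^ 'n ^ 'm"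
  assumes "finite I" and "T = (\<Sum>i\<in>I. tensor (x i) (y i))"
  shows "nuclear_norm linf_norm norm T \<le> (\<Sum>i\<in>I. linf_norm (x i) * norm (y i))"
proof -
  obtain x' y' where xy: "(\<lambda>k. tensor (x' k) (y' k)) sums T"
    "(\<lambda>k. linf_norm (x' k) * norm (y' k)) sums (\<Sum>i\<in>I. linf_norm (x i) * norm (y i))"
    using finite_nuclear_representation[OF assms] by blast
  then show ?thesis
    unfolding nuclear_norm_def
    by (intro cInf_lower bdd_belowI[OF nuclear_values_nonneg] CollectI exI[of _ x'] exI[of _ y'])
      (simp_all add: sums_unique sums_summable)
qed

lemma tensor_column_decomposition:
  "T = (\<Sum>i\<in>UNIV. tensor (axis i 1) (column i T))"
  by (simp add: vec_eq_iff tensor_def column_def axis_def if_distrib[of "\<lambda>c. c * _"] cong: if_cong)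

lemma norm_mult_vec_le:
  assumes "\<And>i. norm (column i T) \<le> b" "l1_norm a \<le> 1" "0 \<le> b"
  shows "norm (T *v a) \<le> b"
proof -
  have "norm (T *v a) \<le> (\<Sum>i\<in>UNIV. norm (a $ i) * b)"
    unfolding matrix_mult_sum
    by (intro sum_norm_le) (simp add: norm_smult_vec mult_left_mono assms(1))
  also have "\<dots> = l1_norm a * b" by (simp add: l1_norm_def sum_distrib_right)
  also have "\<dots> \<le> 1 * b" using assms(2,3) by (rule mult_right_mono)
  finally show ?thesis by simp
qed

lemma norm_column_le_operator_norm:
  fixes T :: "'k::real_normed_field ^ 'n ^ 'm"
  shows "norm (column i T) \<le> operator_norm l1_norm norm ((*v) T)"
proof -
  have "norm (T *v a) \<le> (\<Sum>i\<in>UNIV. norm (column i T))" if "l1_norm a \<le> 1" for a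
    using that by (intro norm_mult_vec_le) (auto intro: member_le_sum sum_nonneg)
  then have "bdd_above ((\<lambda>a. norm (T *v a)) ` {a. l1_norm a \<le> 1})"
    by (intro bdd_aboveI2) auto
  moreover have "l1_norm (axis i 1 :: 'k ^ 'n) = (\<Sum>j\<in>UNIV. if j = i then 1 else 0)"
    unfolding l1_norm_def by (rule sum.cong) (auto simp: axis_def)
  then have "l1_norm (axis i 1 :: 'k ^ 'n) \<le> 1" by simp
  moreover have "T *v axis i 1 = column i T"
    by (simp add: matrix_vector_mult_def column_def vec_eq_iff axis_def
        if_distrib[of "\<lambda>c. _ * c"] cong: if_cong)
  ultimately show ?thesis
    unfolding operator_norm_def by (metis (mono_tags, lifting) cSUP_upper mem_Collect_eq)
qed

text \<open>
  Writing every column as a weighted average of the same cube vertices turns \<open>T\<close> into a sum over the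
  vertices \<open>A\<close> of \<open>tensor x\<^sub>A (cube_vertex U A) / 2 ^ card U\<close>, where the entries of \<open>x\<^sub>A\<close> are the
  weights, one for each column. Since the weights are bounded uniformly by \<open>\<surd>2 * b\<close> and the vertices
  have norm \<open>\<surd>(card U)\<close>, the average costs \<open>\<surd>2 * b * \<surd>(card U)\<close>. The small errors of the columns
  are absorbed by one additional term \<open>tensor (axis i 1) (R i)\<close> for each column.
\<close>

lemma nuclear_norm_le_sqrt_card:
  fixes T :: "'k::{real_normed_field,real_inner} ^ 'n ^ 'm"
  assumes U: "orthonormal U" and col: "\<And>i. column i T \<in> vec.span U"
    and b: "\<And>i. norm (column i T) \<le> b" "0 \<le> b"
  shows "nuclear_norm linf_norm norm T \<le> sqrt 2 * b * sqrt (card U)"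
proof (rule field_le_epsilon)
  fix \<epsilon> :: real assume "0 < \<epsilon>"
  define e where "e = \<epsilon> / CARD('n)"
  have "0 < e" using \<open>0 < \<epsilon>\<close> by (simp add: e_def)
  define q where "q A = (1 / 2 ^ card U) *\<^sub>R cube_vertex U A" for A
  have "\<forall>i. \<exists>x. (\<forall>A. norm (x A) \<le> sqrt 2 * norm (column i T)) \<and>
      norm (column i T - (\<Sum>A\<in>Pow U. x A *s q A)) < e"
    unfolding q_def using approximate_by_cube_vertices[OF U col \<open>0 < e\<close>] by (rule allI)
  from choice[OF this] obtain X where X: "\<And>i A. norm (X i A) \<le> sqrt 2 * norm (column i T)"
    "\<And>i. norm (column i T - (\<Sum>A\<in>Pow U. X i A *s q A)) < e"
    by blast
  define R where "R i = column i T - (\<Sum>A\<in>Pow U. X i A *s q A)" for i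
  define x where "x = case_sum (\<lambda>A. \<chi> i. X i A) (\<lambda>i. axis i 1 :: 'k ^ 'n)"
  define y where "y = case_sum q R"
  have fin: "finite U" using U by (simp add: orthonormal_def)
  have "T = (\<Sum>A\<in>Pow U. tensor (\<chi> i. X i A) (q A)) + (\<Sum>i\<in>UNIV. tensor (axis i 1) (R i))"
  proof -
    have "(\<Sum>i\<in>UNIV. (axis i 1 :: 'k ^ 'n) $ i' * R i $ j) = R i' $ j" for i' j
      by (simp add: axis_def if_distrib[of "\<lambda>c. c * _"] cong: if_cong)
    then show ?thesis
      by (simp add: vec_eq_iff tensor_def R_def column_def)
  qed
  also have "\<dots> = (\<Sum>p\<in>Pow U <+> UNIV. tensor (x p) (y p))"
    using fin by (simp add: sum.Plus x_def y_def)
  finally have "nuclear_norm linf_norm norm T \<le> (\<Sum>p\<in>Pow U <+> UNIV. linf_norm (x p) * norm (y p))"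
    using fin by (intro nuclear_norm_le_finite_sum) simp_all
  also have "\<dots> = (\<Sum>A\<in>Pow U. linf_norm (\<chi> i. X i A) * norm (q A))
      + (\<Sum>i\<in>UNIV. linf_norm (axis i 1 :: 'k ^ 'n) * norm (R i))"
    using fin by (simp add: sum.Plus x_def y_def)
  also have "\<dots> \<le> (\<Sum>A\<in>Pow U. sqrt 2 * b * (sqrt (card U) / 2 ^ card U)) + (\<Sum>i\<in>(UNIV :: 'n set). 1 * e)"
  proof (intro add_mono sum_mono mult_mono)
    show "linf_norm (\<chi> i. X i A) \<le> sqrt 2 * b" for A
    proof (rule linf_norm_le)
      show "norm ((\<chi> i. X i A) $ i) \<le> sqrt 2 * b" for i
        using X(1)[of i A] b(1)[of i] by (simp add: order_trans)
    qed
    show "norm (q A) \<le> sqrt (card U) / 2 ^ card U" for A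
      by (simp add: q_def norm_cube_vertex[OF U])
    show "linf_norm (axis i 1 :: 'k ^ 'n) \<le> 1" for i
      by (rule linf_norm_le) (simp add: axis_def)
    show "norm (R i) \<le> e" for i using X(2)[of i] by (simp add: R_def)
  qed (use b(2) in \<open>simp_all\<close>)
  also have "\<dots> = sqrt 2 * b * sqrt (card U) + \<epsilon>"
    using fin by (simp add: e_def card_Pow)
  finally show "nuclear_norm linf_norm norm T \<le> sqrt 2 * b * sqrt (card U) + \<epsilon>" .
qed

section \<open>Comparison with the 2-summing norm\<close>

definition coordinate_pairing :: "'k::real_normed_field ^ 'm \<Rightarrow> 'k ^ 'm \<Rightarrow> 'k"
  where "coordinate_pairing y z = (\<Sum>j\<in>UNIV. y $ j * z $ j)"

lemma norm_coordinate_pairing_le: "norm (coordinate_pairing y z) \<le> norm y * norm z"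
proof -
  have "norm (coordinate_pairing y z) \<le> (\<Sum>j\<in>UNIV. \<bar>norm (y $ j)\<bar> * \<bar>norm (z $ j)\<bar>)"
    unfolding coordinate_pairing_def by (intro sum_norm_le) (simp add: norm_mult)
  also have "\<dots> \<le> norm y * norm z"
    unfolding norm_vec_def by (rule L2_set_mult_ineq)
  finally show ?thesis .
qed

lemma weak_square_sum_le:
  assumes "\<phi> \<in> dual_ball norm"
  shows "(\<Sum>k<K. (norm (\<phi> (z k)))\<^sup>2) \<le> (\<Sum>k<K. (norm (z k))\<^sup>2)"
  using assms by (intro sum_mono power_mono) (auto simp: dual_ball_def)

lemma weak_square_sum_bdd:
  "bdd_above ((\<lambda>\<phi>. \<Sum>k<K. (norm (\<phi> (z k)))\<^sup>2) ` dual_ball norm)"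
  using weak_square_sum_le by (rule bdd_aboveI2)

lemma zero_in_dual_ball: "(\<lambda>_. 0) \<in> dual_ball norm"
  unfolding dual_ball_def by (auto; unfold_locales; simp)

text \<open>
  The functional \<open>coordinate_pairing y\<close> divided by \<open>norm y\<close> competes in the supremum.
\<close>

lemma L2_set_coordinate_pairing_le:
  fixes y :: "'k::real_normed_field ^ 'm"
  shows "L2_set (\<lambda>k. norm (coordinate_pairing y (z k))) {..<K}
    \<le> norm y * sqrt (SUP \<phi>\<in>dual_ball norm. \<Sum>k<K. (norm (\<phi> (z k)))\<^sup>2)"
proof (cases "y = 0")
  case True
  then show ?thesis by (simp add: coordinate_pairing_def L2_set_def)
next
  case False
  define \<phi> where "\<phi> v = coordinate_pairing y v / of_real (norm y)" for v
  have "Vector_Spaces.linear (*s) (*) \<phi>"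
    by unfold_locales
      (simp_all add: \<phi>_def coordinate_pairing_def distrib_left sum.distrib add_divide_distrib
        sum_distrib_left mult_ac sum_divide_distrib)
  moreover have "norm (\<phi> v) \<le> norm v" for v
    using norm_coordinate_pairing_le[of y v] False by (simp add: \<phi>_def norm_divide field_simps)
  ultimately have "\<phi> \<in> dual_ball norm" by (simp add: dual_ball_def)
  then have "(\<Sum>k<K. (norm (\<phi> (z k)))\<^sup>2) \<le> (SUP \<phi>\<in>dual_ball norm. \<Sum>k<K. (norm (\<phi> (z k)))\<^sup>2)"
    by (intro cSUP_upper weak_square_sum_bdd)
  then have "L2_set (\<lambda>k. norm (\<phi> (z k))) {..<K}
      \<le> sqrt (SUP \<phi>\<in>dual_ball norm. \<Sum>k<K. (norm (\<phi> (z k)))\<^sup>2)"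
    unfolding L2_set_def by (rule real_sqrt_le_mono)
  then have "norm y * L2_set (\<lambda>k. norm (\<phi> (z k))) {..<K}
      \<le> norm y * sqrt (SUP \<phi>\<in>dual_ball norm. \<Sum>k<K. (norm (\<phi> (z k)))\<^sup>2)"
    by (rule mult_left_mono) simp
  moreover have "norm (coordinate_pairing y v) = norm y * norm (\<phi> v)" for v
    using False by (simp add: \<phi>_def norm_divide)
  ultimately show ?thesis by (simp add: L2_set_right_distrib)
qed

lemma L2_set_sum_le: "L2_set (\<lambda>l. \<Sum>k<N. f k l) A \<le> (\<Sum>k<(N::nat). L2_set (f k) A)"
proof (induction N)
  case (Suc N)
  have "L2_set (\<lambda>l. \<Sum>k<Suc N. f k l) A \<le> L2_set (\<lambda>l. \<Sum>k<N. f k l) A + L2_set (f N) A"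
    using L2_set_triangle_ineq[of "\<lambda>l. \<Sum>k<N. f k l" "f N" A] by simp
  with Suc show ?case by simp
qed (simp add: L2_set_def)

lemma transpose_mult_sums:
  fixes T :: "'k::real_normed_field ^ 'n ^ 'm"
  assumes "(\<lambda>k. tensor (x k) (y k)) sums T"
  shows "(\<lambda>k. x k $ i * coordinate_pairing (y k) z) sums (transpose T *v z) $ i"
proof -
  have "(\<lambda>k. tensor (x k) (y k) $ j $ i) sums T $ j $ i" for j
    using assms unfolding sums_def sum_component[symmetric] by (intro tendsto_vec_nth)
  then have "(\<lambda>k. \<Sum>j\<in>UNIV. tensor (x k) (y k) $ j $ i * z $ j) sums (\<Sum>j\<in>UNIV. T $ j $ i * z $ j)"
    by (intro sums_sum sums_mult2)
  then show ?thesis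
    by (simp add: tensor_def coordinate_pairing_def matrix_vector_mult_def transpose_def
        sum_distrib_left mult_ac)
qed

text \<open>
  A rank one operator \<open>z \<mapsto> coordinate_pairing (y k) z *s x k\<close> satisfies the 2-summing inequality with
  constant \<open>linf_norm (x k) * norm (y k)\<close>, and Minkowski's inequality adds these constants. To pass
  from finitely many terms to the series, a coordinate \<open>i l\<close> attaining the maximum norm is fixed
  for each \<open>z l\<close>, so that only finitely many scalar series have to converge.
\<close>

lemma two_summing_bound_of_nuclear_representation:
  fixes T :: "'k::real_normed_field ^ 'n ^ 'm" and z :: "nat \<Rightarrow> 'k ^ 'm"
  assumes T: "(\<lambda>k. tensor (x k) (y k)) sums T"
    and s: "(\<lambda>k. linf_norm (x k) * norm (y k)) sums s" and "s \<le> c"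
  shows "(\<Sum>l<K. (linf_norm (transpose T *v z l))\<^sup>2)
    \<le> c\<^sup>2 * (SUP \<phi>\<in>dual_ball norm. \<Sum>l<K. (norm (\<phi> (z l)))\<^sup>2)"
proof -
  define M where "M = (SUP \<phi>\<in>dual_ball norm. \<Sum>l<K. (norm (\<phi> (z l)))\<^sup>2)"
  have "(\<Sum>l<K. (norm ((\<lambda>_. 0 :: 'k) (z l)))\<^sup>2) \<le> M"
    unfolding M_def by (rule cSUP_upper[OF zero_in_dual_ball weak_square_sum_bdd])
  then have "0 \<le> M" by simp
  have s0: "0 \<le> s"
    using s by (rule sums_le[OF _ sums_zero, rotated]) (simp add: linf_norm_nonneg)
  have "\<forall>l. \<exists>i. linf_norm (transpose T *v z l) = norm ((transpose T *v z l) $ i)"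
    using linf_norm_attained by blast
  then obtain i where i: "\<And>l. linf_norm (transpose T *v z l) = norm ((transpose T *v z l) $ i l)"
    by metis
  have "L2_set (\<lambda>l. linf_norm (transpose T *v z l)) {..<K} \<le> s * sqrt M"
  proof (rule LIMSEQ_le_const2)
    show "(\<lambda>N. L2_set (\<lambda>l. norm (\<Sum>k<N. x k $ i l * coordinate_pairing (y k) (z l))) {..<K})
        \<longlonglongrightarrow> L2_set (\<lambda>l. linf_norm (transpose T *v z l)) {..<K}"
      unfolding L2_set_def i
      using transpose_mult_sums[OF T] unfolding sums_def by (intro tendsto_intros)
    have "L2_set (\<lambda>l. norm (\<Sum>k<N. x k $ i l * coordinate_pairing (y k) (z l))) {..<K} \<le> s * sqrt M" for N
    proof -
      have "L2_set (\<lambda>l. norm (\<Sum>k<N. x k $ i l * coordinate_pairing (y k) (z l))) {..<K}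
          \<le> L2_set (\<lambda>l. \<Sum>k<N. linf_norm (x k) * norm (coordinate_pairing (y k) (z l))) {..<K}"
        by (intro L2_set_mono sum_norm_le)
          (simp_all add: norm_mult mult_right_mono norm_nth_le_linf_norm)
      also have "\<dots> \<le> (\<Sum>k<N. L2_set (\<lambda>l. linf_norm (x k) * norm (coordinate_pairing (y k) (z l))) {..<K})"
        by (rule L2_set_sum_le)
      also have "\<dots> = (\<Sum>k<N. linf_norm (x k) * L2_set (\<lambda>l. norm (coordinate_pairing (y k) (z l))) {..<K})"
        by (simp add: L2_set_right_distrib linf_norm_nonneg)
      also have "\<dots> \<le> (\<Sum>k<N. linf_norm (x k) * (norm (y k) * sqrt M))"
        unfolding M_def
        by (intro sum_mono mult_left_mono L2_set_coordinate_pairing_le linf_norm_nonneg)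
      also have "\<dots> = (\<Sum>k<N. linf_norm (x k) * norm (y k)) * sqrt M"
        by (simp only: sum_distrib_right mult.assoc)
      also have "\<dots> \<le> s * sqrt M"
      proof (rule mult_right_mono)
        show "(\<Sum>k<N. linf_norm (x k) * norm (y k)) \<le> s"
          using s sum_le_suminf[of "\<lambda>k. linf_norm (x k) * norm (y k)" "{..<N}"]
          by (auto simp: sums_iff linf_norm_nonneg)
      qed (use \<open>0 \<le> M\<close> in simp)
      finally show ?thesis .
    qed
    then show "\<exists>N0. \<forall>N\<ge>N0. L2_set (\<lambda>l. norm (\<Sum>k<N. x k $ i l * coordinate_pairing (y k) (z l))) {..<K} \<le> s * sqrt M"
      by blast
  qed
  also have "\<dots> \<le> c * sqrt M" using \<open>s \<le> c\<close> \<open>0 \<le> M\<close> by (simp add: mult_right_mono)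
  finally have "(L2_set (\<lambda>l. linf_norm (transpose T *v z l)) {..<K})\<^sup>2 \<le> (c * sqrt M)\<^sup>2"
    by (rule power_mono) simp
  then show ?thesis
    using \<open>0 \<le> M\<close> unfolding L2_set_def M_def[symmetric]
    by (simp add: power_mult_distrib sum_nonneg)
qed

lemma two_summing_norm_le_nuclear_norm:
  fixes T :: "'k::real_normed_field ^ 'n ^ 'm"
  shows "two_summing_norm norm linf_norm ((*v) (transpose T)) \<le> nuclear_norm linf_norm norm T"
  unfolding nuclear_norm_def
proof (rule cInf_greatest)
  show "{\<Sum>k. linf_norm (x k) * norm (y k) | x y. (\<lambda>k. tensor (x k) (y k)) sums T \<and>
      summable (\<lambda>k. linf_norm (x k) * norm (y k))} \<noteq> {}"
    using finite_nuclear_representation[OF finite tensor_column_decomposition[of T]]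
    by (auto simp: sums_iff)
next
  fix s
  assume s: "s \<in> {\<Sum>k. linf_norm (x k) * norm (y k) | x y. (\<lambda>k. tensor (x k) (y k)) sums T \<and>
      summable (\<lambda>k. linf_norm (x k) * norm (y k))}"
  then obtain x y where xy: "(\<lambda>k. tensor (x k) (y k)) sums T"
    "(\<lambda>k. linf_norm (x k) * norm (y k)) sums s"
    by (auto dest: summable_sums)
  have "0 \<le> s" using s by (rule nuclear_values_nonneg)
  show "two_summing_norm norm linf_norm ((*v) (transpose T)) \<le> s"
  proof (rule field_le_epsilon)
    fix e :: real assume "0 < e"
    with \<open>0 \<le> s\<close> show "two_summing_norm norm linf_norm ((*v) (transpose T)) \<le> s + e"
      unfolding two_summing_norm_def
      using two_summing_bound_of_nuclear_representation[OF xy, of "s + e"]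
      by (intro cInf_lower bdd_belowI[of _ 0]) auto
  qed
qed

text \<open>
  The 2-summing inequality for a single vector says that the adjoint has operator norm at most \<open>c\<close>;
  testing it on the conjugate of \<open>T *v a\<close> gives the same bound for \<open>T\<close>.
\<close>

lemma operator_norm_le_two_summing_norm:
  fixes T :: "'k::{real_normed_field,real_inner} ^ 'n ^ 'm"
  shows "operator_norm l1_norm norm ((*v) T) \<le> two_summing_norm norm linf_norm ((*v) (transpose T))"
  unfolding two_summing_norm_def
proof (rule cInf_greatest)
  obtain x y and s :: real where xy: "(\<lambda>k. tensor (x k) (y k)) sums T"
    "(\<lambda>k. linf_norm (x k) * norm (y k)) sums s"
    using finite_nuclear_representation[OF finite tensor_column_decomposition[of T]] by blast
  show "{c. c > 0 \<and> (\<forall>(K::nat) z. (\<Sum>k<K. (linf_norm (transpose T *v z k))\<^sup>2)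
      \<le> c\<^sup>2 * (SUP \<phi>\<in>dual_ball norm. \<Sum>k<K. (norm (\<phi> (z k)))\<^sup>2))} \<noteq> {}"
    using two_summing_bound_of_nuclear_representation[OF xy, of "max s 1"]
    by (auto intro!: exI[of _ "max s 1"])
next
  fix c
  assume "c \<in> {c. c > 0 \<and> (\<forall>(K::nat) z. (\<Sum>k<K. (linf_norm (transpose T *v z k))\<^sup>2)
      \<le> c\<^sup>2 * (SUP \<phi>\<in>dual_ball norm. \<Sum>k<K. (norm (\<phi> (z k)))\<^sup>2))}"
  then have "0 < c" and c: "\<And>(K::nat) z. (\<Sum>k<K. (linf_norm (transpose T *v z k))\<^sup>2)
      \<le> c\<^sup>2 * (SUP \<phi>\<in>dual_ball norm. \<Sum>k<K. (norm (\<phi> (z k)))\<^sup>2)"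
    by auto
  have bound: "linf_norm (transpose T *v w) \<le> c * norm w" for w
  proof (rule power2_le_imp_le)
    have "(linf_norm (transpose T *v w))\<^sup>2
        \<le> c\<^sup>2 * (SUP \<phi>\<in>dual_ball norm. \<Sum>k<Suc 0. (norm (\<phi> w))\<^sup>2)"
      using c[where z = "\<lambda>_. w" and K = "Suc 0"] by simp
    also have "\<dots> \<le> c\<^sup>2 * (\<Sum>k<Suc 0. (norm w)\<^sup>2)"
      using zero_in_dual_ball
      by (intro mult_left_mono cSUP_least weak_square_sum_le) auto
    finally show "(linf_norm (transpose T *v w))\<^sup>2 \<le> (c * norm w)\<^sup>2"
      by (simp add: power_mult_distrib)
  qed (use \<open>0 < c\<close> in simp)
  show "operator_norm l1_norm norm ((*v) T) \<le> c"
    unfolding operator_norm_def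
  proof (rule cSUP_least)
    show "{a :: 'k ^ 'n. l1_norm a \<le> 1} \<noteq> {}"
      by (auto simp: l1_norm_def intro!: exI[of _ 0])
  next
    fix a :: "'k ^ 'n"
    assume "a \<in> {a. l1_norm a \<le> 1}"
    then have a: "(\<Sum>i\<in>UNIV. norm (a $ i)) \<le> 1" by (simp add: l1_norm_def)
    define v where "v = T *v a"
    define w where "w = (\<chi> j. conjugate (v $ j))"
    have nw: "norm w = norm v" by (simp add: norm_vec_def w_def)
    have "of_real ((norm v)\<^sup>2) = (\<Sum>j\<in>UNIV. w $ j * v $ j)"
      by (simp only: hdot_self[symmetric] hdot_def w_def vec_lambda_beta)
    also have "\<dots> = (\<Sum>i\<in>UNIV. a $ i * (transpose T *v w) $ i)"
      unfolding v_def by (rule transpose_pairing)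
    finally have "norm (of_real ((norm v)\<^sup>2) :: 'k) \<le> (\<Sum>i\<in>UNIV. norm (a $ i * (transpose T *v w) $ i))"
      by (simp only: norm_sum)
    also have "\<dots> \<le> (\<Sum>i\<in>UNIV. norm (a $ i) * (c * norm v))"
      unfolding norm_mult nw[symmetric]
      using bound[of w] norm_nth_le_linf_norm by (intro sum_mono mult_left_mono) (auto intro: order_trans)
    also have "\<dots> = (\<Sum>i\<in>UNIV. norm (a $ i)) * (c * norm v)" by (simp only: sum_distrib_right)
    also have "\<dots> \<le> 1 * (c * norm v)" using a \<open>0 < c\<close> by (intro mult_right_mono) auto
    finally have "norm v * norm v \<le> c * norm v"
      by (simp only: norm_of_real abs_power2 mult_1_left) (simp only: power2_eq_square)
    then have "norm v \<le> c" using \<open>0 < c\<close> by (cases "v = 0") auto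
    then show "norm (T *v a) \<le> c" by (simp add: v_def)
  qed
qed

text \<open>
  The remaining estimate is \<open>nuclear_norm_le_sqrt_card\<close> for an orthonormal basis of a space of
  dimension at most \<open>r\<close> containing the columns, whose norms the operator norm on \<open>\<ell>\<^sub>1\<close> dominates.
\<close>

theorem corollary4p5:
  fixes T :: "'k::{real_normed_field,real_inner} ^ 'n ^ 'm" and r :: nat
  assumes "rank T = r"
  shows "operator_norm l1_norm norm ((*v) T)
           \<le> two_summing_norm norm linf_norm ((*v) (transpose T))
       \<and> two_summing_norm norm linf_norm ((*v) (transpose T))
           \<le> nuclear_norm linf_norm norm T
       \<and> nuclear_norm linf_norm norm T
           \<le> sqrt (2 * real r) * operator_norm l1_norm norm ((*v) T)"
proof (intro conjI operator_norm_le_two_summing_norm two_summing_norm_le_nuclear_norm)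
  let ?b = "operator_norm l1_norm norm ((*v) T)"
  have b: "norm (column i T) \<le> ?b" for i by (rule norm_column_le_operator_norm)
  then have b0: "0 \<le> ?b" by (rule order_trans[OF norm_ge_zero])
  obtain U :: "('k ^ 'm) set" where U: "orthonormal U" "card U \<le> rank T" "\<And>i. column i T \<in> vec.span U"
    using columns_in_span_of_rank[of T] by blast
  have "nuclear_norm linf_norm norm T \<le> sqrt 2 * ?b * sqrt (card U)"
    using U(1,3) b b0 by (rule nuclear_norm_le_sqrt_card)
  also have "\<dots> \<le> sqrt 2 * ?b * sqrt r"
    using U(2) assms b0 by (intro mult_left_mono) auto
  also have "\<dots> = sqrt (2 * real r) * ?b" by (simp add: real_sqrt_mult)
  finally show "nuclear_norm linf_norm norm T \<le> sqrt (2 * real r) * ?b" .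
qed

end
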